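(* Let $F=(f_1,\dots,f_m)\colon\mathbb Z_p^{n}\to\mathbb Z_p^{m}$ be uniformly differentiable modulo $p$ on $\mathbb Z_p^n$ with integer-valued partial derivatives modulo $p$. Suppose that for some integer $k\ge N_1(F)$ the function $F$ is equiprobable modulo $p^k$ and that for every $\mathbf u\in\{0,1,\dots,p^k-1\}^n$ the Jacobi matrix $F'_1(\mathbf u)$, reduced modulo $p$, has rank exactly $m$ over the field $\mathbb Z/p$. Then $F$ is asymptotically equiprobable.
   Context: $\mathbb Z_p$, $\mathbb Q_p$, $\|\cdot\|_p$ are the $p$-adic integers, numbers and norm; for vectors $\|(u_1,\dots,u_n)\|_p=\max_i\|u_i\|_p$, and $\mathbf a\equiv\mathbf b\pmod{p^s}$ means $\|\mathbf a-\mathbf b\|_p\le p^{-s}$. $F\colon\mathbb Z_p^n\to\mathbb Z_p^m$ is uniformly differentiable modulo $p^k$ on $\mathbb Z_p^n$ if there exist $N\in\mathbb N$ and for every $\mathbf u\in\mathbb Z_p^n$ an $n\times m$ matrix $F'_k(\mathbf u)$ over $\mathbb Q_p$ (the Jacobi matrix modulo $p^k$; its entries are the partial derivatives modulo $p^k$) such that for every integer $K\ge N$, every $\mathbf u$ and every row vector $\mathbf h\in\mathbb Z_p^n$ with $\|\mathbf h\|_p\le p^{-K}$: $F(\mathbf u+\mathbf h)\equiv F(\mathbf u)+\mathbf hF'_k(\mathbf u)\pmod{p^{k+K}}$. The least such $N$ is denoted $N_k(F)$. $F$ has integer-valued partial derivatives modulo $p^k$ if $F'_k(\mathbf u)$ can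 be chosen with entries in $\mathbb Z_p$ for every $\mathbf u$. $F\bmod p^k$ is the map $\{0,\dots,p^k-1\}^n\to(\mathbb Z/p^k)^m$, $\mathbf x\mapsto F(\mathbf x)\bmod p^k$ (componentwise); $F$ is equiprobable modulo $p^k$ if every point of $(\mathbb Z/p^k)^m$ has the same number of preimages under $F\bmod p^k$, and asymptotically equiprobable if it is equiprobable modulo $p^k$ for all sufficiently large $k$. *)

theory Defs
  imports
    "HOL-Analysis.Analysis"
    "HOL-Computational_Algebra.Fraction_Field"
    "Berlekamp_Zassenhaus.Finite_Field"
begin

text \<open>
  The prime \<open>p\<close> is \<open>CARD('p)\<close> for a type \<open>'p\<close> of class \<open>prime_card\<close>. The ring of \<open>p\<close>-adic
  integers is the inverse limit of the rings \<open>\<int>/p\<^sup>k\<close>; the \<open>k\<close>-th entry of a sequence is the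
  residue modulo \<open>p\<^sup>k\<close>, represented in \<open>{0..<p\<^sup>k}\<close>.
\<close>

typedef (overloaded) ('p::prime_card) padic_int =
  "{x :: nat \<Rightarrow> int. \<forall>k. x k \<in> {0..<int CARD('p) ^ k} \<and> x (Suc k) mod int CARD('p) ^ k = x k}"
  morphisms residue Abs_padic_int
proof -
  have "int CARD('p) > 0"
    using prime_card_int[where 'a='p] prime_gt_0_int by blast
  then show ?thesis by (intro exI[of _ "\<lambda>_. 0"]) auto
qed

setup_lifting type_definition_padic_int

lemma prime_card_gt_0 [simp]: "int CARD('p::prime_card) > 0"
  using prime_card_int[where 'a='p] prime_gt_0_int by blast

lemma mod_Suc_power_mod [simp]:
  fixes a b :: int
  shows "a mod (b * b ^ k) mod b ^ k = a mod b ^ k"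
  by (simp add: mod_mod_cancel)

instantiation padic_int :: (prime_card) comm_ring_1
begin

lift_definition zero_padic_int :: "'a padic_int" is "\<lambda>_. 0" by simp

lift_definition one_padic_int :: "'a padic_int" is "\<lambda>k. 1 mod int CARD('a) ^ k" by simp

lift_definition plus_padic_int :: "'a padic_int \<Rightarrow> 'a padic_int \<Rightarrow> 'a padic_int"
  is "\<lambda>x y k. (x k + y k) mod int CARD('a) ^ k"
  by simp (metis mod_add_eq)

lift_definition uminus_padic_int :: "'a padic_int \<Rightarrow> 'a padic_int"
  is "\<lambda>x k. (- x k) mod int CARD('a) ^ k"
  by simp (metis mod_minus_eq)

lift_definition minus_padic_int :: "'a padic_int \<Rightarrow> 'a padic_int \<Rightarrow> 'a padic_int"
  is "\<lambda>x y k. (x k - y k) mod int CARD('a) ^ k"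
  by simp (metis mod_diff_eq)

lift_definition times_padic_int :: "'a padic_int \<Rightarrow> 'a padic_int \<Rightarrow> 'a padic_int"
  is "\<lambda>x y k. (x k * y k) mod int CARD('a) ^ k"
  by simp (metis mod_mult_eq)

instance
proof
  show "(0::'a padic_int) \<noteq> 1"
  proof (transfer, rule notI)
    assume "(\<lambda>_. 0) = (\<lambda>k. 1 mod int CARD('a) ^ k)"
    then have "0 = 1 mod int CARD('a) ^ 1" by (rule fun_cong)
    then show False using prime_card_int[where 'a='a] prime_gt_1_int by fastforce
  qed
qed (transfer; auto simp: fun_eq_iff mod_simps algebra_simps)+

end

lemma residue_bounds: "residue (x::'p::prime_card padic_int) k \<in> {0..<int CARD('p) ^ k}"
  by transfer simp

lemma residue_mod:
  assumes "i \<le> j"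
  shows "residue (x::'p::prime_card padic_int) j mod int CARD('p) ^ i = residue x i"
  using assms
proof (induction j rule: dec_induct)
  case base
  show ?case using residue_bounds[of x i] by simp
next
  case (step j)
  have "residue x (Suc j) mod int CARD('p) ^ i
      = residue x (Suc j) mod int CARD('p) ^ j mod int CARD('p) ^ i"
    using step by (simp add: mod_mod_cancel le_imp_power_dvd)
  also have "residue x (Suc j) mod int CARD('p) ^ j = residue x j"
    by transfer simp
  finally show ?case using step by simp
qed

lemma residue_eq_0_iff:
  assumes "i \<le> j"
  shows "residue (x::'p::prime_card padic_int) i = 0 \<longleftrightarrow> int CARD('p) ^ i dvd residue x j"
  using residue_mod[OF assms, of x] by (simp add: dvd_eq_mod_eq_0)

lemma residue_eq_0_mono:
  "residue (x::'p::prime_card padic_int) j = 0 \<Longrightarrow> i \<le> j \<Longrightarrow> residue x i = 0"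
  using residue_eq_0_iff by fastforce

definition padic_val :: "'p::prime_card padic_int \<Rightarrow> nat" where
  "padic_val x = (LEAST k. residue x (Suc k) \<noteq> 0)"

lemma residue_le_padic_val_iff:
  assumes "(x::'p::prime_card padic_int) \<noteq> 0"
  shows "residue x k = 0 \<longleftrightarrow> k \<le> padic_val x"
proof -
  obtain j where j: "residue x j \<noteq> 0"
    using assms by transfer auto
  have "residue x 0 = 0" using residue_bounds[of x 0] by simp
  with j obtain j' where j': "j = Suc j'" by (cases j) auto
  have 1: "residue x (Suc (padic_val x)) \<noteq> 0"
    unfolding padic_val_def by (rule LeastI[of _ j']) (use j j' in simp)
  have 2: "residue x (padic_val x) = 0"
  proof (cases "padic_val x")
    case 0
    then show ?thesis using \<open>residue x 0 = 0\<close> by simp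
  next
    case (Suc i)
    then show ?thesis
      using not_less_Least[of i "\<lambda>k. residue x (Suc k) \<noteq> 0"] by (auto simp: padic_val_def)
  qed
  show ?thesis
    using 1 2 residue_eq_0_mono[of x] by (meson not_less_eq_eq)
qed

lemma residue_mult_val:
  assumes "(x::'p::prime_card padic_int) \<noteq> 0" "y \<noteq> 0"
  shows "residue (x * y) (padic_val x + padic_val y) = 0"
    and "residue (x * y) (Suc (padic_val x + padic_val y)) \<noteq> 0"
proof -
  let ?p = "int CARD('p)" and ?v = "padic_val x" and ?w = "padic_val y"
  define N where "N = Suc (?v + ?w)"
  have p: "prime ?p" by (rule prime_card_int)
  have "?p ^ ?v dvd residue x N" "\<not> ?p ^ Suc ?v dvd residue x N"
    using residue_eq_0_iff[of ?v N x] residue_eq_0_iff[of "Suc ?v" N x]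
      residue_le_padic_val_iff[OF assms(1)] by (auto simp: N_def)
  then obtain a where a: "residue x N = ?p ^ ?v * a" "\<not> ?p dvd a"
    by (auto elim!: dvdE)
  have "?p ^ ?w dvd residue y N" "\<not> ?p ^ Suc ?w dvd residue y N"
    using residue_eq_0_iff[of ?w N y] residue_eq_0_iff[of "Suc ?w" N y]
      residue_le_padic_val_iff[OF assms(2)] by (auto simp: N_def)
  then obtain b where b: "residue y N = ?p ^ ?w * b" "\<not> ?p dvd b"
    by (auto elim!: dvdE)
  have N: "residue (x * y) N = (?p ^ (?v + ?w) * (a * b)) mod ?p ^ N"
    using a b by (simp add: times_padic_int.rep_eq power_add ac_simps)
  have ab: "\<not> ?p dvd a * b"
    using a b p prime_dvd_mult_iff by blast
  have "\<not> ?p ^ N dvd ?p ^ (?v + ?w) * (a * b)"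
    using ab prime_gt_0_int[OF p] by (simp add: N_def mult.commute[of ?p])
  then show "residue (x * y) (Suc (?v + ?w)) \<noteq> 0"
    using N by (simp add: N_def dvd_eq_mod_eq_0)
  have "?p ^ (?v + ?w) dvd residue (x * y) N"
    unfolding N by (rule dvd_mod) (auto simp: N_def)
  then show "residue (x * y) (?v + ?w) = 0"
    using residue_eq_0_iff[of "?v + ?w" N "x * y"] by (simp add: N_def)
qed

instance padic_int :: (prime_card) idom
proof
  fix x y :: "'a padic_int"
  assume "x \<noteq> 0" "y \<noteq> 0"
  then have "residue (x * y) (Suc (padic_val x + padic_val y)) \<noteq> 0"
    by (rule residue_mult_val)
  then show "x * y \<noteq> 0" by (auto simp: zero_padic_int.rep_eq)
qed

lemma padic_val_mult:
  assumes "(x::'p::prime_card padic_int) \<noteq> 0" "y \<noteq> 0"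
  shows "padic_val (x * y) = padic_val x + padic_val y"
  using residue_mult_val[OF assms] residue_le_padic_val_iff[of "x * y"] assms
  by (simp add: le_antisym not_less_eq_eq)

definition padic_int_norm :: "'p::prime_card padic_int \<Rightarrow> real" where
  "padic_int_norm x = (if x = 0 then 0 else 1 / real CARD('p) ^ padic_val x)"

lemma padic_int_norm_mult:
  "padic_int_norm ((x::'p::prime_card padic_int) * y) = padic_int_norm x * padic_int_norm y"
  by (simp add: padic_int_norm_def padic_val_mult power_add)

lemma padic_int_norm_eq_0_iff [simp]: "padic_int_norm (x::'p::prime_card padic_int) = 0 \<longleftrightarrow> x = 0"
  using prime_card_gt_0[where 'p='p] by (simp add: padic_int_norm_def)

lemma padic_int_norm_le_iff:
  "padic_int_norm (x::'p::prime_card padic_int) \<le> 1 / real CARD('p) ^ s \<longleftrightarrow> residue x s = 0"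
proof (cases "x = 0")
  case True
  then show ?thesis by (simp add: padic_int_norm_def zero_padic_int.rep_eq)
next
  case False
  have "1 < real CARD('p)"
    using prime_gt_1_nat[OF prime_card[where 'a='p]] by simp
  then show ?thesis
    using False by (simp add: padic_int_norm_def residue_le_padic_val_iff field_simps)
qed

type_synonym 'p padic = "'p padic_int fract"

definition padic_norm :: "'p::prime_card padic \<Rightarrow> real" where
  "padic_norm q =
    (THE r. \<exists>a b. b \<noteq> 0 \<and> q = Fract a b \<and> r = padic_int_norm a / padic_int_norm b)"

lemma padic_norm_Fract:
  assumes "(b::'p::prime_card padic_int) \<noteq> 0"
  shows "padic_norm (Fract a b) = padic_int_norm a / padic_int_norm b"
  unfolding padic_norm_def
proof (rule the_equality)
  fix r
  assume "\<exists>c d. d \<noteq> 0 \<and> Fract a b = Fract c d \<and> r = padic_int_norm c / padic_int_norm d"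
  then show "r = padic_int_norm a / padic_int_norm b"
    using assms by (auto simp: eq_fract frac_eq_eq simp flip: padic_int_norm_mult)
qed (use assms in blast)

abbreviation to_padic :: "'p::prime_card padic_int \<Rightarrow> 'p padic" where
  "to_padic x \<equiv> Fract x 1"

lemma padic_norm_to_padic: "padic_norm (to_padic x) = padic_int_norm x"
proof -
  have "padic_int_norm (1::'a padic_int) = 1"
    using padic_int_norm_mult[of 1 "1::'a padic_int"] by simp
  then show ?thesis by (simp add: padic_norm_Fract)
qed

definition to_padic_vec :: "'p::prime_card padic_int ^ 'n \<Rightarrow> 'p padic ^ 'n" where
  "to_padic_vec u = (\<chi> i. to_padic (u $ i))"

definition to_padic_mat :: "'p::prime_card padic_int ^ 'm ^ 'n \<Rightarrow> 'p padic ^ 'm ^ 'n" where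
  "to_padic_mat A = (\<chi> i j. to_padic (A $ i $ j))"

definition padic_vec_norm :: "'p::prime_card padic ^ 'n \<Rightarrow> real" where
  "padic_vec_norm u = Max (range (\<lambda>i. padic_norm (u $ i)))"

definition padic_vec_cong :: "nat \<Rightarrow> 'p::prime_card padic ^ 'n \<Rightarrow> 'p padic ^ 'n \<Rightarrow> bool" where
  "padic_vec_cong s a b \<longleftrightarrow> padic_vec_norm (a - b) \<le> 1 / real CARD('p) ^ s"

definition jacobi_mod_from ::
    "nat \<Rightarrow> nat \<Rightarrow> ('p::prime_card padic_int ^ 'n \<Rightarrow> 'p padic_int ^ 'm)
      \<Rightarrow> ('p padic_int ^ 'n \<Rightarrow> 'p padic ^ 'm ^ 'n) \<Rightarrow> bool" where
  "jacobi_mod_from N k F J \<longleftrightarrow>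
    (\<forall>K\<ge>N. \<forall>u h. padic_vec_norm (to_padic_vec h) \<le> 1 / real CARD('p) ^ K \<longrightarrow>
      padic_vec_cong (k + K)
        (to_padic_vec (F (u + h))) (to_padic_vec (F u) + to_padic_vec h v* J u))"

definition jacobi_mod ::
    "nat \<Rightarrow> ('p::prime_card padic_int ^ 'n \<Rightarrow> 'p padic_int ^ 'm)
      \<Rightarrow> ('p padic_int ^ 'n \<Rightarrow> 'p padic ^ 'm ^ 'n) \<Rightarrow> bool" where
  "jacobi_mod k F J \<longleftrightarrow> (\<exists>N. jacobi_mod_from N k F J)"

definition uniformly_differentiable_mod ::
    "nat \<Rightarrow> ('p::prime_card padic_int ^ 'n \<Rightarrow> 'p padic_int ^ 'm) \<Rightarrow> bool" where
  "uniformly_differentiable_mod k F \<longleftrightarrow> (\<exists>N J. jacobi_mod_from N k F J)"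

text \<open>The number \<open>N\<^sub>k(F)\<close>; meaningful only if \<open>F\<close> is uniformly differentiable modulo \<open>p\<^sup>k\<close>.\<close>

definition diff_threshold ::
    "nat \<Rightarrow> ('p::prime_card padic_int ^ 'n \<Rightarrow> 'p padic_int ^ 'm) \<Rightarrow> nat" where
  "diff_threshold k F = (LEAST N. \<exists>J. jacobi_mod_from N k F J)"

definition integer_valued_derivatives_mod ::
    "nat \<Rightarrow> ('p::prime_card padic_int ^ 'n \<Rightarrow> 'p padic_int ^ 'm) \<Rightarrow> bool" where
  "integer_valued_derivatives_mod k F \<longleftrightarrow>
    (\<exists>J. jacobi_mod k F J \<and> (\<forall>u i j. J u $ i $ j \<in> range to_padic))"

definition residue_box :: "nat \<Rightarrow> nat \<Rightarrow> (nat ^ 'n) set" where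
  "residue_box p k = {x. \<forall>i. x $ i < p ^ k}"

definition of_nat_vec :: "nat ^ 'n \<Rightarrow> 'a::semiring_1 ^ 'n" where
  "of_nat_vec x = (\<chi> i. of_nat (x $ i))"

text \<open>\<open>F mod p\<^sup>k\<close>, with \<open>\<int>/p\<^sup>k\<close> represented by \<open>{0..<p\<^sup>k}\<close>.\<close>

definition reduced_map ::
    "nat \<Rightarrow> ('p::prime_card padic_int ^ 'n \<Rightarrow> 'p padic_int ^ 'm) \<Rightarrow> nat ^ 'n \<Rightarrow> nat ^ 'm" where
  "reduced_map k F x = (\<chi> j. nat (residue (F (of_nat_vec x) $ j) k))"

definition equiprobable_mod ::
    "nat \<Rightarrow> ('p::prime_card padic_int ^ 'n \<Rightarrow> 'p padic_int ^ 'm) \<Rightarrow> bool" where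
  "equiprobable_mod k F \<longleftrightarrow>
    (\<exists>c. \<forall>y \<in> residue_box CARD('p) k.
      card {x \<in> residue_box CARD('p) k. reduced_map k F x = y} = c)"

definition asymptotically_equiprobable ::
    "('p::prime_card padic_int ^ 'n \<Rightarrow> 'p padic_int ^ 'm) \<Rightarrow> bool" where
  "asymptotically_equiprobable F \<longleftrightarrow> (\<forall>\<^sub>F k in sequentially. equiprobable_mod k F)"

definition reduce_mat_mod_p :: "'p::prime_card padic_int ^ 'm ^ 'n \<Rightarrow> 'p mod_ring ^ 'm ^ 'n" where
  "reduce_mat_mod_p A = (\<chi> i j. of_int (residue (A $ i $ j) 1))"

end

theory Submission
  imports Defs
begin

text \<open>
  The Jacobi matrix modulo \<open>p\<close> is unique modulo \<open>p\<close>, so the given integral one can be used with the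
  minimal threshold \<open>N\<^sub>1(F)\<close>; it is moreover periodic modulo \<open>p\<close> with period \<open>p\<^sup>k\<close> for
  \<open>k \<ge> N\<^sub>1(F)\<close>, so it has rank \<open>m\<close> everywhere. For \<open>K \<ge> k\<close> every point modulo \<open>p\<^bsup>K+1\<^esup>\<close> is
  \<open>x + p\<^sup>K t\<close> with \<open>t\<close> modulo \<open>p\<close>, and \<open>F (x + p\<^sup>K t) \<equiv> F x + p\<^sup>K (t F\<^sub>1'(x))\<close> modulo
  \<open>p\<^bsup>K+1\<^esup>\<close>. Hence each preimage \<open>x\<close> of \<open>y mod p\<^sup>K\<close> lifts to exactly as many preimages of \<open>y\<close> as a
  linear system of rank \<open>m\<close> in \<open>n\<close> unknowns over \<open>\<int>/p\<close> has solutions, namely \<open>p\<^bsup>n-m\<^esup>\<close>, and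
  equiprobability passes from \<open>p\<^sup>K\<close> to \<open>p\<^bsup>K+1\<^esup>\<close>.
\<close>

section \<open>The ultrametric norm on p-adic integers, numbers and vectors\<close>

lemma padic_int_norm_nonneg: "0 \<le> padic_int_norm (x :: 'p::prime_card padic_int)"
  by (simp add: padic_int_norm_def)

lemma padic_int_norm_minus [simp]: "padic_int_norm (- x) = padic_int_norm (x :: 'p::prime_card padic_int)"
proof -
  have "padic_int_norm (1 :: 'p padic_int) = 1"
    using padic_int_norm_mult [of 1 "1 :: 'p padic_int"] by simp
  then have "padic_int_norm (- 1 :: 'p padic_int) ^ 2 = 1"
    using padic_int_norm_mult [of "- 1" "- 1 :: 'p padic_int"] by (simp add: power2_eq_square)
  then have "padic_int_norm (- 1 :: 'p padic_int) = 1"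
    using padic_int_norm_nonneg [of "- 1 :: 'p padic_int"] by (auto simp: power2_eq_1_iff)
  then show ?thesis
    using padic_int_norm_mult [of "- 1" x] by simp
qed

lemma padic_int_norm_add_le:
  "padic_int_norm (x + y) \<le> max (padic_int_norm x) (padic_int_norm (y :: 'p::prime_card padic_int))"
proof (cases "x = 0 \<or> y = 0")
  case False
  define s where "s = min (padic_val x) (padic_val y)"
  have "residue x s = 0" "residue y s = 0"
    using False by (auto simp: s_def residue_le_padic_val_iff)
  then have "padic_int_norm (x + y) \<le> 1 / real CARD('p) ^ s"
    by (simp add: padic_int_norm_le_iff plus_padic_int.rep_eq)
  also have "\<dots> = padic_int_norm x \<or> \<dots> = padic_int_norm y"
    using False by (auto simp: s_def padic_int_norm_def min_def)
  then have "1 / real CARD('p) ^ s \<le> max (padic_int_norm x) (padic_int_norm y)"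
    by auto
  finally show ?thesis .
qed (auto simp: padic_int_norm_nonneg)

lemma padic_norm_mult: "padic_norm (x * y) = padic_norm x * padic_norm (y :: 'p::prime_card padic)"
  by (cases x; cases y) (simp add: padic_norm_Fract padic_int_norm_mult)

lemma padic_norm_minus [simp]: "padic_norm (- x) = padic_norm (x :: 'p::prime_card padic)"
  by (cases x) (simp add: padic_norm_Fract)

lemma padic_norm_nonneg: "0 \<le> padic_norm (x :: 'p::prime_card padic)"
  by (cases x) (simp add: padic_norm_Fract padic_int_norm_nonneg)

text \<open>Over the common denominator \<open>b * d\<close> this is the ultrametric inequality for
  numerators in Z_p. A bound \<open>r\<close> in place of the maximum carries over to finite
  sums.\<close>

lemma padic_norm_add_le:
  assumes "padic_norm x \<le> r" "padic_norm y \<le> r"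
  shows "padic_norm (x + y :: 'p::prime_card padic) \<le> r"
proof -
  obtain a b c d where xy: "x = Fract a b" "b \<noteq> 0" "y = Fract c d" "d \<noteq> 0"
    by (cases x; cases y) auto
  have pos: "padic_int_norm (b * d) > 0"
    using xy padic_int_norm_nonneg [of "b * d"] by (simp add: less_le)
  have "padic_norm x = padic_int_norm (a * d) / padic_int_norm (b * d)"
    and "padic_norm y = padic_int_norm (c * b) / padic_int_norm (b * d)"
    using xy by (simp_all add: padic_norm_Fract padic_int_norm_mult)
  then have "padic_int_norm (a * d) \<le> r * padic_int_norm (b * d)"
    and "padic_int_norm (c * b) \<le> r * padic_int_norm (b * d)"
    using assms pos by (simp_all add: pos_divide_le_eq)
  then have "padic_int_norm (a * d + c * b) \<le> r * padic_int_norm (b * d)"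
    using padic_int_norm_add_le [of "a * d" "c * b"] by linarith
  then show ?thesis
    using xy pos by (simp add: padic_norm_Fract pos_divide_le_eq)
qed

lemma padic_norm_diff_le:
  assumes "padic_norm x \<le> r" "padic_norm y \<le> r"
  shows "padic_norm (x - y :: 'p::prime_card padic) \<le> r"
  using padic_norm_add_le [of x r "- y"] assms by simp

lemma padic_norm_sum_le:
  fixes f :: "'i \<Rightarrow> 'p::prime_card padic"
  assumes "\<And>i. i \<in> S \<Longrightarrow> padic_norm (f i) \<le> r" "0 \<le> r"
  shows "padic_norm (sum f S) \<le> r"
  using assms
proof (induction S rule: infinite_finite_induct)
  case (insert i S)
  then show ?case by (simp add: padic_norm_add_le)
qed (simp_all add: Zero_fract_def padic_norm_Fract padic_int_norm_def)

lemma padic_vec_norm_le_iff: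
  "padic_vec_norm (v :: 'p::prime_card padic ^ 'n) \<le> r \<longleftrightarrow> (\<forall>i. padic_norm (v $ i) \<le> r)"
  by (auto simp: padic_vec_norm_def)

lemma padic_vec_norm_vector_matrix_mult_le:
  fixes A :: "'p::prime_card padic ^ 'm ^ 'n"
  assumes h: "padic_vec_norm h \<le> r" and A: "\<And>i j. padic_norm (A $ i $ j) \<le> s"
  shows "padic_vec_norm (h v* A) \<le> r * s"
proof -
  have r: "\<And>i. padic_norm (h $ i) \<le> r"
    using h by (simp add: padic_vec_norm_le_iff)
  \<comment> \<open>Index types are inhabited, so some norm, which is nonnegative, lies below each
    bound.\<close>
  have "0 \<le> r" "0 \<le> s"
    using r A padic_norm_nonneg order_trans by blast+
  then show ?thesis
    unfolding padic_vec_norm_le_iff vector_matrix_mult_def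
    by (auto intro!: padic_norm_sum_le mult_mono r A simp: padic_norm_mult padic_norm_nonneg)
qed

section \<open>Powers of p, and norm conditions expressed by residues\<close>

lemma residue_of_nat: "residue (of_nat a :: 'p::prime_card padic_int) s = int a mod int CARD('p) ^ s"
  by (induction a)
    (simp_all add: zero_padic_int.rep_eq one_padic_int.rep_eq plus_padic_int.rep_eq mod_simps)

lemma padic_int_norm_of_nat_power:
  "padic_int_norm (of_nat (CARD('p) ^ s) :: 'p::prime_card padic_int) = 1 / real CARD('p) ^ s"
proof -
  have p: "1 < int CARD('p)"
    using prime_gt_1_int [OF prime_card_int [where 'a = 'p]] .
  define x where "x = (of_nat (CARD('p) ^ s) :: 'p padic_int)"
  have 1: "residue x s = 0"
    by (simp add: x_def residue_of_nat flip: of_nat_power)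
  have "residue x (Suc s) = int CARD('p) ^ s"
    using p unfolding x_def residue_of_nat by (simp add: mod_pos_pos_trivial)
  then have 2: "residue x (Suc s) \<noteq> 0"
    using p by simp
  then have "x \<noteq> 0"
    by (auto simp: zero_padic_int.rep_eq)
  with 1 2 have "padic_val x = s"
    by (simp add: residue_le_padic_val_iff)
  with \<open>x \<noteq> 0\<close> show ?thesis
    by (simp add: padic_int_norm_def x_def)
qed

lemma to_padic_sum: "to_padic (sum f S) = (\<Sum>i\<in>S. to_padic (f i :: 'p::prime_card padic_int))"
proof (induction S rule: infinite_finite_induct)
  case (insert i S)
  have "to_padic (f i + sum f S) = to_padic (f i) + to_padic (sum f S)"
    by simp
  then show ?case
    using insert by simp
qed (simp_all add: Zero_fract_def)

lemma to_padic_vec_add: "to_padic_vec (u + v) = to_padic_vec u + to_padic_vec v"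
  by (simp add: to_padic_vec_def vec_eq_iff)

lemma to_padic_vec_diff: "to_padic_vec (u - v) = to_padic_vec u - to_padic_vec v"
  by (simp add: to_padic_vec_def vec_eq_iff)

lemma to_padic_vec_vector_matrix_mult:
  "to_padic_vec (h v* A) = to_padic_vec h v* to_padic_mat A"
  by (simp add: to_padic_vec_def to_padic_mat_def vector_matrix_mult_def vec_eq_iff to_padic_sum)

lemma padic_vec_norm_to_padic_vec_le_iff:
  "padic_vec_norm (to_padic_vec (v :: 'p::prime_card padic_int ^ 'n)) \<le> 1 / real CARD('p) ^ s
    \<longleftrightarrow> (\<forall>i. residue (v $ i) s = 0)"
  by (simp add: padic_vec_norm_le_iff to_padic_vec_def padic_norm_to_padic padic_int_norm_le_iff)

text \<open>For an integral Jacobi matrix both sides of the congruence lie in Z_p, so norm bounds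
  become vanishing residues and the lifting argument can avoid fractions.\<close>

lemma jacobi_mod_from_integral_iff:
  fixes F :: "'p::prime_card padic_int ^ 'n \<Rightarrow> 'p padic_int ^ 'm"
  shows "jacobi_mod_from N k F (\<lambda>u. to_padic_mat (J u)) \<longleftrightarrow>
    (\<forall>K\<ge>N. \<forall>u h. (\<forall>i. residue (h $ i) K = 0) \<longrightarrow>
      (\<forall>j. residue ((F (u + h) - (F u + h v* J u)) $ j) (k + K) = 0))"
  unfolding jacobi_mod_from_def padic_vec_cong_def padic_vec_norm_to_padic_vec_le_iff
    to_padic_vec_vector_matrix_mult [symmetric] to_padic_vec_add [symmetric]
    to_padic_vec_diff [symmetric] ..

section \<open>Uniqueness of the Jacobi matrix modulo p^k\<close>

lemma vector_matrix_mult_axis: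
  fixes A :: "'a::comm_semiring_1 ^ 'm ^ 'n"
  shows "(axis i c v* A) $ j = c * A $ i $ j"
  by (simp add: vector_matrix_mult_def axis_def if_distrib [of "\<lambda>x. x * _"] cong: if_cong)

text \<open>Test both expansions on the vector with p^K in position \<open>i\<close> and 0
  elsewhere. Their difference is p^K times an entry of \<open>J u - J' u\<close> and has norm at
  most p^-(k+K); cancel p^K.\<close>

lemma jacobi_mod_from_unique:
  fixes F :: "'p::prime_card padic_int ^ 'n \<Rightarrow> 'p padic_int ^ 'm"
  assumes J: "jacobi_mod_from N k F J" and J': "jacobi_mod_from M k F J'"
  shows "padic_norm ((J u - J' u) $ i $ j) \<le> 1 / real CARD('p) ^ k"
proof -
  \<comment> \<open>Beyond both thresholds, so that both expansions apply.\<close>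
  define K where "K = max N M"
  define q where "q = (of_nat (CARD('p) ^ K) :: 'p padic_int)"
  define h where "h = (axis i q :: 'p padic_int ^ 'n)"
  have q: "padic_int_norm q = 1 / real CARD('p) ^ K"
    unfolding q_def by (rule padic_int_norm_of_nat_power)
  then have "padic_vec_norm (to_padic_vec h) \<le> 1 / real CARD('p) ^ K"
    by (auto simp: padic_vec_norm_le_iff to_padic_vec_def padic_norm_to_padic h_def axis_def
        padic_int_norm_def)
  then have "padic_vec_cong (k + K) (to_padic_vec (F (u + h))) (to_padic_vec (F u) + to_padic_vec h v* J u)"
    and "padic_vec_cong (k + K) (to_padic_vec (F (u + h))) (to_padic_vec (F u) + to_padic_vec h v* J' u)"
    using J J' by (auto simp: jacobi_mod_from_def K_def)
  then have "padic_norm ((to_padic_vec (F (u + h)) - (to_padic_vec (F u) + to_padic_vec h v* J' u)) $ j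
      - (to_padic_vec (F (u + h)) - (to_padic_vec (F u) + to_padic_vec h v* J u)) $ j)
      \<le> 1 / real CARD('p) ^ (k + K)"
    unfolding padic_vec_cong_def padic_vec_norm_le_iff by (blast intro: padic_norm_diff_le)
  also have "(to_padic_vec (F (u + h)) - (to_padic_vec (F u) + to_padic_vec h v* J' u)) $ j
      - (to_padic_vec (F (u + h)) - (to_padic_vec (F u) + to_padic_vec h v* J u)) $ j
      = (to_padic_vec h v* (J u - J' u)) $ j"
    by (simp add: vector_matrix_mult_diff_rdistrib)
  also have "to_padic_vec h = axis i (to_padic q)"
    by (simp add: h_def to_padic_vec_def axis_def vec_eq_iff Zero_fract_def)
  finally show ?thesis
    using q by (simp add: vector_matrix_mult_axis padic_norm_mult padic_norm_to_padic power_add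
        divide_simps split: if_splits)
qed

text \<open>The threshold belongs to \<open>F\<close>, not to the chosen matrix: the matrices differ
  by at most p^-k, and a displacement of norm at most p^-K shrinks this to p^-(k+K). An integral
  matrix thus inherits the least threshold.\<close>

lemma jacobi_mod_from_change:
  fixes F :: "'p::prime_card padic_int ^ 'n \<Rightarrow> 'p padic_int ^ 'm"
  assumes J: "jacobi_mod_from N k F J" and J': "jacobi_mod_from M k F J'"
  shows "jacobi_mod_from N k F J'"
  unfolding jacobi_mod_from_def
proof (intro allI impI)
  fix K u and h :: "'p padic_int ^ 'n"
  assume K: "N \<le> K" and h: "padic_vec_norm (to_padic_vec h) \<le> 1 / real CARD('p) ^ K"
  let ?a = "to_padic_vec (F (u + h))" and ?b = "to_padic_vec (F u)" and ?h = "to_padic_vec h"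
  have "padic_vec_cong (k + K) ?a (?b + ?h v* J u)"
    using J K h by (simp add: jacobi_mod_from_def)
  moreover have "padic_vec_norm (?h v* (J u - J' u)) \<le> 1 / real CARD('p) ^ (k + K)"
    using padic_vec_norm_vector_matrix_mult_le [OF h jacobi_mod_from_unique [OF J J']]
    by (simp add: power_add mult.commute)
  moreover have "?a - (?b + ?h v* J' u) = (?a - (?b + ?h v* J u)) + ?h v* (J u - J' u)"
    by (simp add: vector_matrix_mult_diff_rdistrib)
  ultimately show "padic_vec_cong (k + K) ?a (?b + ?h v* J' u)"
    unfolding padic_vec_cong_def padic_vec_norm_le_iff
    by (auto intro: padic_norm_add_le simp only: vector_add_component)
qed


section \<open>First-order expansion modulo p^(K+1) and reduction to Z/p\<close>

lemma residue_diff_eq_0_iff: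
  "residue (x - y) s = 0 \<longleftrightarrow> residue x s = residue (y :: 'p::prime_card padic_int) s"
proof -
  have "residue (x - y) s = 0 \<longleftrightarrow>
      residue x s mod int CARD('p) ^ s = residue y s mod int CARD('p) ^ s"
    by (simp add: minus_padic_int.rep_eq mod_eq_dvd_iff dvd_eq_mod_eq_0)
  then show ?thesis
    by (simp add: residue_mod)
qed

text \<open>Multiplication by p^K shifts the p-adic digits by K places, so modulo p^(K+1) only the
  lowest digit of \<open>z\<close> survives. This turns congruences modulo p^(K+1) into equations
  over Z/p.\<close>

lemma residue_of_nat_power_mult:
  "residue (of_nat (CARD('p) ^ K) * z :: 'p::prime_card padic_int) (Suc K)
    = int CARD('p) ^ K * residue z 1"
proof -
  have "residue (of_nat (CARD('p) ^ K) * z) (Suc K)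
      = (int CARD('p) ^ K * residue z (Suc K)) mod (int CARD('p) ^ K * int CARD('p))"
    unfolding times_padic_int.rep_eq residue_of_nat by (simp add: mod_simps mult.commute)
  also have "\<dots> = int CARD('p) ^ K * (residue z (Suc K) mod int CARD('p) ^ 1)"
    unfolding power_one_right by (rule mult_mod_right [symmetric])
  also have "residue z (Suc K) mod int CARD('p) ^ 1 = residue z 1"
    by (rule residue_mod) simp
  finally show ?thesis .
qed

lemma of_int_mod_ring_eq_iff:
  "of_int a = (of_int b :: 'p::prime_card mod_ring) \<longleftrightarrow> int CARD('p) dvd a - b"
  by (simp add: of_int_of_int_mod_ring of_int_mod_ring_def mod_eq_dvd_iff
      Abs_mod_ring_inject flip: mod_eq_dvd_iff)

lemma of_int_residue_0: "of_int (residue (0 :: 'p::prime_card padic_int) 1) = (0 :: 'p mod_ring)"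
  by (simp add: zero_padic_int.rep_eq)

lemma of_int_mod_card: "of_int (a mod int CARD('p)) = (of_int a :: 'p::prime_card mod_ring)"
  using of_int_mod_CHAR [where 'a = "'p mod_ring", of a] by simp

lemma of_int_residue_add:
  "of_int (residue (x + y) 1) = (of_int (residue x 1) + of_int (residue y 1) :: 'p mod_ring)"
  for x y :: "'p::prime_card padic_int"
  by (simp add: plus_padic_int.rep_eq of_int_mod_card)

lemma of_int_residue_mult:
  "of_int (residue (x * y) 1) = (of_int (residue x 1) * of_int (residue y 1) :: 'p mod_ring)"
  for x y :: "'p::prime_card padic_int"
  by (simp add: times_padic_int.rep_eq of_int_mod_card)

lemma of_int_residue_sum:
  "of_int (residue (sum f S) 1) = (\<Sum>i\<in>S. of_int (residue (f i) 1) :: 'p mod_ring)"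
  for f :: "'i \<Rightarrow> 'p::prime_card padic_int"
  by (induction S rule: infinite_finite_induct)
    (simp_all add: of_int_residue_0 [simplified] of_int_residue_add [simplified])

lemma of_int_residue_vector_matrix_mult:
  fixes A :: "'p::prime_card padic_int ^ 'm ^ 'n"
  shows "of_int (residue ((g v* A) $ j) 1)
    = ((\<chi> i. of_int (residue (g $ i) 1)) v* reduce_mat_mod_p A) $ j"
  by (simp only: vector_matrix_mult_def reduce_mat_mod_p_def vec_lambda_beta of_int_residue_sum
      of_int_residue_mult)

text \<open>The linear term of the displacement p^K \<open>g\<close> is p^K times
  \<open>g v* J u\<close>, so modulo p^(K+1) it enters only through its residue modulo p.\<close>

lemma residue_lift:
  fixes F :: "'p::prime_card padic_int ^ 'n \<Rightarrow> 'p padic_int ^ 'm"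
  assumes J: "jacobi_mod_from N 1 F (\<lambda>u. to_padic_mat (J u))" and "N \<le> K"
  shows "residue (F (u + of_nat (CARD('p) ^ K) *s g) $ j) (Suc K)
    = (residue (F u $ j) (Suc K) + int CARD('p) ^ K * residue ((g v* J u) $ j) 1)
        mod int CARD('p) ^ Suc K"
proof -
  define h where "h = of_nat (CARD('p) ^ K) *s g"
  have "residue (h $ i) K = 0" for i
    using residue_mod [of K "Suc K" "h $ i"]
    unfolding h_def vector_smult_component residue_of_nat_power_mult by simp
  then have "residue ((F (u + h) - (F u + h v* J u)) $ j) (Suc K) = 0"
    using J \<open>N \<le> K\<close> by (simp add: jacobi_mod_from_integral_iff)
  then have "residue (F (u + h) $ j) (Suc K) = residue (F u $ j + (h v* J u) $ j) (Suc K)"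
    by (simp add: residue_diff_eq_0_iff)
  also have "(h v* J u) $ j = of_nat (CARD('p) ^ K) * (g v* J u) $ j"
    by (simp add: h_def vector_matrix_mult_def sum_distrib_left mult.assoc)
  finally show ?thesis
    unfolding plus_padic_int.rep_eq residue_of_nat_power_mult h_def .
qed

text \<open>Reach \<open>u + h + g\<close> from \<open>u\<close> directly and by way of
  \<open>u + h\<close>, where \<open>g\<close> is p^N times a unit vector. Comparing the expansions
  modulo p^(N+1) and cancelling p^N compares one entry of the two matrices modulo p.\<close>

lemma reduce_mat_mod_p_periodic:
  fixes F :: "'p::prime_card padic_int ^ 'n \<Rightarrow> 'p padic_int ^ 'm"
  assumes J: "jacobi_mod_from N 1 F (\<lambda>u. to_padic_mat (J u))" and h: "\<And>i. residue (h $ i) N = 0"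
  shows "reduce_mat_mod_p (J (u + h)) = reduce_mat_mod_p (J u)"
proof -
  have "residue (J (u + h) $ i $ j) 1 = residue (J u $ i $ j) 1" for i j
  proof -
    define q where "q = (of_nat (CARD('p) ^ N) :: 'p padic_int)"
    define g where "g = (axis i q :: 'p padic_int ^ 'n)"
    have g: "residue (g $ l) N = 0" for l
      by (auto simp: g_def axis_def zero_padic_int.rep_eq q_def residue_of_nat simp flip: of_nat_power)
    have *: "residue ((F (v + f) - (F v + f v* J v)) $ j) (Suc N) = 0"
      if "\<And>l. residue (f $ l) N = 0" for v f
      using J that by (simp add: jacobi_mod_from_integral_iff)
    define a where "a = (F (u + (h + g)) - (F u + (h + g) v* J u)) $ j"
    define b where "b = (F (u + h) - (F u + h v* J u)) $ j"
    define c where "c = (F ((u + h) + g) - (F (u + h) + g v* J (u + h))) $ j"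
    have "residue a (Suc N) = 0" "residue b (Suc N) = 0" "residue c (Suc N) = 0"
      unfolding a_def b_def c_def using h g
      by (intro *; simp add: plus_padic_int.rep_eq)+
    \<comment> \<open>In this combination all values of \<open>F\<close> and the term
      \<open>h v* J u\<close> cancel.\<close>
    then have "residue (c - a + b) (Suc N) = 0"
      by (simp add: plus_padic_int.rep_eq minus_padic_int.rep_eq)
    also have "c - a + b = (g v* J u) $ j - (g v* J (u + h)) $ j"
      by (simp add: a_def b_def c_def algebra_simps)
    also have "\<dots> = q * (J u $ i $ j - J (u + h) $ i $ j)"
      by (simp add: g_def vector_matrix_mult_axis algebra_simps)
    finally have "residue (J u $ i $ j - J (u + h) $ i $ j) 1 = 0"
      unfolding q_def residue_of_nat_power_mult by simp
    then show ?thesis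
      by (simp only: residue_diff_eq_0_iff)
  qed
  then show ?thesis
    by (simp add: reduce_mat_mod_p_def vec_eq_iff)
qed

section \<open>Linear systems of full rank over a finite field\<close>

lemma card_vector_matrix_mult_fibre:
  fixes A :: "'a::{field,finite} ^ 'm ^ 'n"
  assumes "rank A = CARD('m)"
  shows "card {t. t v* A = w} = CARD('a) ^ CARD('n) div CARD('a) ^ CARD('m)"
proof -
  have "vec.span (rows A) = UNIV"
    using assms vec.dim_eq_full [of "rows A"] by (simp add: row_rank_def_gen vec.dimension_def card_cart_basis)
  \<comment> \<open>Since the rows of \<open>A\<close> span, \<open>B\<close> yields the particular
    solution \<open>w v* B\<close> of the system for every \<open>w\<close>.\<close>
  then obtain B where B: "B ** A = mat 1"
    using matrix_left_invertible_span_rows_gen by blast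
  define q where "q = card {t. t v* A = 0}"
  \<comment> \<open>Each fibre is the kernel translated by a particular solution.\<close>
  have fibre: "card {t. t v* A = w} = q" for w
  proof -
    have wB: "w v* B v* A = w"
      by (simp add: vector_matrix_mul_assoc B)
    have "bij_betw (\<lambda>t. t + w v* B) {t. t v* A = 0} {t. t v* A = w}"
      by (rule bij_betw_byWitness [where f' = "\<lambda>t. t - w v* B"])
        (use wB in \<open>auto simp: vector_matrix_left_distrib vector_matrix_mult_diff_distrib\<close>)
    then show ?thesis
      by (simp add: q_def bij_betw_same_card)
  qed
  \<comment> \<open>The equally large fibres partition the whole space, which determines their
    size.\<close>
  have "(\<Union>w. {t. t v* A = w}) = UNIV"
    by auto
  then have "CARD('a) ^ CARD('n) = card (\<Union>w. {t. t v* A = w})"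
    by simp
  also have "\<dots> = (\<Sum>w\<in>UNIV. card {t. t v* A = w})"
    by (rule card_UN_disjoint) auto
  also have "\<dots> = CARD('a) ^ CARD('m) * q"
    by (simp add: fibre)
  finally show ?thesis
    using fibre [of w] by simp
qed

section \<open>Counting the lifts of a preimage from p^K to p^(K+1)\<close>

lemma finite_residue_box: "finite (residue_box p k :: (nat ^ 'n) set)"
proof -
  have "(residue_box p k :: (nat ^ 'n) set) \<subseteq> vec_lambda ` (UNIV \<rightarrow>\<^sub>E {..<p ^ k})"
  proof
    fix x :: "nat ^ 'n" assume "x \<in> residue_box p k"
    then have "($) x \<in> UNIV \<rightarrow>\<^sub>E {..<p ^ k}" "x = vec_lambda (($) x)"
      by (auto simp: residue_box_def)
    then show "x \<in> vec_lambda ` (UNIV \<rightarrow>\<^sub>E {..<p ^ k})" by blast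
  qed
  then show ?thesis
    by (rule finite_subset) (auto intro!: finite_PiE)
qed

lemma reduced_map_eq_iff:
  fixes F :: "'p::prime_card padic_int ^ 'n \<Rightarrow> 'p padic_int ^ 'm"
  shows "reduced_map k F x = y \<longleftrightarrow> (\<forall>j. residue (F (of_nat_vec x) $ j) k = int (y $ j))"
proof -
  have "nat (residue z k) = a \<longleftrightarrow> residue z k = int a" for z :: "'p padic_int" and a
    using residue_bounds [of z k] by auto
  then show ?thesis
    by (simp add: reduced_map_def vec_eq_iff)
qed

lemma of_nat_vec_lift:
  "of_nat_vec (\<chi> i. x $ i + p ^ K * t $ i)
    = (of_nat_vec x + of_nat (p ^ K) *s of_nat_vec t :: 'a::comm_semiring_1 ^ 'n)"
  by (simp add: of_nat_vec_def vec_eq_iff)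

text \<open>The correction term is a multiple of p^K, hence invisible modulo p^K: only preimages of
  \<open>y\<close> modulo p^K can lift to preimages of \<open>y\<close>.\<close>

lemma reduced_map_lift:
  fixes F :: "'p::prime_card padic_int ^ 'n \<Rightarrow> 'p padic_int ^ 'm"
  assumes J: "jacobi_mod_from N 1 F (\<lambda>u. to_padic_mat (J u))" and K: "N \<le> K"
    and eq: "reduced_map (Suc K) F (\<chi> i. x $ i + CARD('p) ^ K * t $ i) = y"
  shows "reduced_map K F x = (\<chi> j. y $ j mod CARD('p) ^ K)"
  unfolding reduced_map_eq_iff
proof
  fix j
  let ?p = "int CARD('p)" and ?u = "of_nat_vec x :: 'p padic_int ^ 'n"
  have "int (y $ j) = (residue (F ?u $ j) (Suc K)
      + ?p ^ K * residue ((of_nat_vec t v* J ?u) $ j) 1) mod ?p ^ Suc K"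
    using eq residue_lift [OF J K] unfolding reduced_map_eq_iff of_nat_vec_lift by metis
  then have "int (y $ j) mod ?p ^ K = residue (F ?u $ j) (Suc K) mod ?p ^ K"
    by simp
  also have "\<dots> = residue (F ?u $ j) K"
    by (rule residue_mod) simp
  finally show "residue (F ?u $ j) K = int ((\<chi> j. y $ j mod CARD('p) ^ K) $ j)"
    by (simp add: of_nat_mod)
qed

text \<open>The target \<open>y\<close> and the value at \<open>x\<close> already agree modulo p^K.
  Dividing their discrepancy modulo p^(K+1) by p^K leaves a linear system for \<open>t\<close> over
  Z/p.\<close>

lemma reduced_map_lift_iff:
  fixes F :: "'p::prime_card padic_int ^ 'n \<Rightarrow> 'p padic_int ^ 'm"
  assumes J: "jacobi_mod_from N 1 F (\<lambda>u. to_padic_mat (J u))" and K: "N \<le> K"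
    and y: "y \<in> residue_box CARD('p) (Suc K)"
    and x: "reduced_map K F x = (\<chi> j. y $ j mod CARD('p) ^ K)"
  shows "reduced_map (Suc K) F (\<chi> i. x $ i + CARD('p) ^ K * t $ i) = y \<longleftrightarrow>
    of_nat_vec t v* reduce_mat_mod_p (J (of_nat_vec x))
      = (\<chi> j. of_int ((int (y $ j) - residue (F (of_nat_vec x) $ j) (Suc K)) div int CARD('p) ^ K))"
proof -
  let ?p = "int CARD('p)" and ?u = "of_nat_vec x :: 'p padic_int ^ 'n"
  define r where "r j = residue (F ?u $ j) (Suc K)" for j
  define d where "d j = (int (y $ j) - r j) div ?p ^ K" for j
  define g where "g j = residue ((of_nat_vec t v* J ?u) $ j) 1" for j
  have p: "0 < ?p" by simp
  \<comment> \<open>The hypothesis on \<open>x\<close> makes the division by p^K exact.\<close>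
  have d: "int (y $ j) - r j = ?p ^ K * d j" for j
  proof -
    have "r j mod ?p ^ K = residue (F ?u $ j) K"
      unfolding r_def by (rule residue_mod) simp
    also have "\<dots> = int (y $ j) mod ?p ^ K"
      using x by (simp add: reduced_map_eq_iff of_nat_mod)
    finally show ?thesis
      by (simp add: d_def mod_eq_dvd_iff [symmetric])
  qed
  have t: "(\<chi> i. of_int (residue (of_nat_vec t $ i :: 'p padic_int) 1)) = (of_nat_vec t :: 'p mod_ring ^ 'n)"
    unfolding of_nat_vec_def vec_lambda_beta residue_of_nat power_one_right of_int_mod_card
    by simp
  have g: "of_int (g j) = (of_nat_vec t v* reduce_mat_mod_p (J ?u)) $ j" for j
    unfolding g_def of_int_residue_vector_matrix_mult t ..
  have "residue (F (of_nat_vec (\<chi> i. x $ i + CARD('p) ^ K * t $ i)) $ j) (Suc K) = int (y $ j)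
      \<longleftrightarrow> of_int (g j) = (of_int (d j) :: 'p mod_ring)" for j
  proof -
    have yj: "int (y $ j) mod ?p ^ Suc K = int (y $ j)"
      using y by (simp add: residue_box_def mod_pos_pos_trivial flip: of_nat_power of_nat_mult)
    have "residue (F (of_nat_vec (\<chi> i. x $ i + CARD('p) ^ K * t $ i)) $ j) (Suc K)
        = (r j + ?p ^ K * g j) mod ?p ^ Suc K"
      unfolding of_nat_vec_lift residue_lift [OF J K] r_def g_def ..
    also have "\<dots> = int (y $ j) \<longleftrightarrow> ?p ^ Suc K dvd (r j + ?p ^ K * g j) - int (y $ j)"
      by (subst yj [symmetric]) (rule mod_eq_dvd_iff)
    also have "(r j + ?p ^ K * g j) - int (y $ j) = ?p ^ K * (g j - d j)"
      using d [of j] by (simp add: algebra_simps)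
    also have "?p ^ Suc K dvd \<dots> \<longleftrightarrow> ?p dvd g j - d j"
      using p by (simp add: mult.commute [of ?p])
    finally show ?thesis
      by (simp add: of_int_mod_ring_eq_iff)
  qed
  then show ?thesis
    unfolding reduced_map_eq_iff by (simp add: g vec_eq_iff d_def r_def)
qed

text \<open>Writing \<open>z\<close> as x + p^K t, with t its quotient by p^K, matches the preimages
  of \<open>y\<close> above \<open>x\<close> with the solutions of a linear system. Their number
  depends on neither \<open>x\<close> nor \<open>y\<close>.\<close>

lemma card_lifts:
  fixes F :: "'p::prime_card padic_int ^ 'n \<Rightarrow> 'p padic_int ^ 'm"
  assumes J: "jacobi_mod_from N 1 F (\<lambda>u. to_padic_mat (J u))" and K: "N \<le> K"
    and y: "y \<in> residue_box CARD('p) (Suc K)"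
    and x: "x \<in> residue_box CARD('p) K" "reduced_map K F x = (\<chi> j. y $ j mod CARD('p) ^ K)"
    and rank: "rank (reduce_mat_mod_p (J (of_nat_vec x))) = CARD('m)"
  shows "card {z \<in> residue_box CARD('p) (Suc K). reduced_map (Suc K) F z = y \<and>
      (\<chi> i. z $ i mod CARD('p) ^ K) = x} = CARD('p) ^ CARD('n) div CARD('p) ^ CARD('m)"
    (is "card ?Z = _")
proof -
  let ?p = "CARD('p)"
  \<comment> \<open>Representatives in 0, ..., p - 1 of vectors over Z/p; these are the digit
    vectors at place K.\<close>
  define \<tau> where "\<tau> t = (\<chi> i. nat (to_int_mod_ring (t $ i)))" for t :: "'p mod_ring ^ 'n"
  define lift where "lift t = (\<chi> i. x $ i + ?p ^ K * t $ i)" for t :: "nat ^ 'n"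
  let ?A = "reduce_mat_mod_p (J (of_nat_vec x))"
  have p: "0 < ?p" using prime_card_gt_0 [where 'p = 'p] by simp
  have to_int: "0 \<le> to_int_mod_ring a" "to_int_mod_ring a < int ?p" for a :: "'p mod_ring"
    using range_to_int_mod_ring [where 'a = 'p] by (auto simp: set_eq_iff)
  obtain w where w: "\<And>t. reduced_map (Suc K) F (lift t) = y \<longleftrightarrow> of_nat_vec t v* ?A = w"
    unfolding lift_def using reduced_map_lift_iff [OF J K y x(2)] by meson
  have \<tau>: "of_nat_vec (\<tau> t) = t" for t
    using to_int by (simp add: of_nat_vec_def \<tau>_def vec_eq_iff of_nat_of_int_mod_ring)
  have \<tau>': "\<tau> (of_nat_vec t) = t" if "\<And>i. t $ i < ?p" for t
    using that by (simp add: of_nat_vec_def \<tau>_def vec_eq_iff of_nat_of_int_mod_ring)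
  have xi: "x $ i < ?p ^ K" for i
    using x(1) by (simp add: residue_box_def)
  have lift_mod: "(\<chi> i. lift t $ i mod ?p ^ K) = x" and lift_div: "(\<chi> i. lift t $ i div ?p ^ K) = t" for t
    using xi by (simp_all add: lift_def vec_eq_iff)
  have lift_box: "lift (\<tau> t) \<in> residue_box ?p (Suc K)" for t
  proof -
    have "lift (\<tau> t) $ i < ?p ^ Suc K" for i
    proof -
      have "\<tau> t $ i + 1 \<le> ?p"
        using to_int [of "t $ i"] by (simp add: \<tau>_def)
      then have "?p ^ K * (\<tau> t $ i + 1) \<le> ?p ^ K * ?p"
        by (rule mult_le_mono2)
      then show ?thesis
        using xi [of i] by (simp add: lift_def algebra_simps)
    qed
    then show ?thesis by (simp add: residue_box_def)
  qed
  have lift_of: "lift (\<chi> i. z $ i div ?p ^ K) = z" if "(\<chi> i. z $ i mod ?p ^ K) = x" for z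
    by (simp add: lift_def vec_eq_iff flip: that)
  have div_less: "z $ i div ?p ^ K < ?p" if "z \<in> residue_box ?p (Suc K)" for z :: "nat ^ 'n" and i
    using that p by (simp add: residue_box_def less_mult_imp_div_less mult.commute)
  have "bij_betw (\<lambda>t. lift (\<tau> t)) {t. t v* ?A = w} ?Z"
  proof (rule bij_betw_byWitness [where f' = "\<lambda>z. of_nat_vec (\<chi> i. z $ i div ?p ^ K)"])
    show "\<forall>t\<in>{t. t v* ?A = w}. of_nat_vec (\<chi> i. lift (\<tau> t) $ i div ?p ^ K) = t"
      by (simp only: lift_div \<tau>) simp
    show "\<forall>z\<in>?Z. lift (\<tau> (of_nat_vec (\<chi> i. z $ i div ?p ^ K))) = z"
      by (auto simp: \<tau>' div_less lift_of)
    show "(\<lambda>t. lift (\<tau> t)) ` {t. t v* ?A = w} \<subseteq> ?Z"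
      by (auto simp: w \<tau> lift_mod lift_box)
    show "(\<lambda>z. of_nat_vec (\<chi> i. z $ i div ?p ^ K)) ` ?Z \<subseteq> {t. t v* ?A = w}"
    proof
      fix t :: "'p mod_ring ^ 'n" assume "t \<in> (\<lambda>z. of_nat_vec (\<chi> i. z $ i div ?p ^ K)) ` ?Z"
      then obtain z where "z \<in> ?Z" "t = of_nat_vec (\<chi> i. z $ i div ?p ^ K)"
        by blast
      then show "t \<in> {t. t v* ?A = w}"
        using w [of "\<chi> i. z $ i div ?p ^ K"] lift_of [of z] by simp
    qed
  qed
  then show ?thesis
    using card_vector_matrix_mult_fibre [OF rank, of w] by (simp add: bij_betw_same_card)
qed

text \<open>Sorted by their reduction modulo p^K, the preimages of \<open>y\<close> form
  \<open>c\<close> classes, one above each preimage of \<open>y\<close> mod p^K, and all classes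
  have the same size.\<close>

lemma equiprobable_mod_Suc:
  fixes F :: "'p::prime_card padic_int ^ 'n \<Rightarrow> 'p padic_int ^ 'm"
  assumes J: "jacobi_mod_from N 1 F (\<lambda>u. to_padic_mat (J u))" and K: "N \<le> K"
    and rank: "\<And>x. x \<in> residue_box CARD('p) K \<Longrightarrow>
      rank (reduce_mat_mod_p (J (of_nat_vec x))) = CARD('m)"
    and equi: "equiprobable_mod K F"
  shows "equiprobable_mod (Suc K) F"
proof -
  let ?p = "CARD('p)"
  let ?q = "?p ^ CARD('n) div ?p ^ CARD('m)"
  have p: "0 < ?p" using prime_card_gt_0 [where 'p = 'p] by simp
  obtain c where c: "\<And>y. y \<in> residue_box ?p K \<Longrightarrow>
      card {x \<in> residue_box ?p K. reduced_map K F x = y} = c"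
    using equi by (auto simp: equiprobable_mod_def)
  have "card {z \<in> residue_box ?p (Suc K). reduced_map (Suc K) F z = y} = c * ?q"
    if y: "y \<in> residue_box ?p (Suc K)" for y
  proof -
    let ?Z = "{z \<in> residue_box ?p (Suc K). reduced_map (Suc K) F z = y}"
    let ?r = "\<lambda>z :: nat ^ 'n. \<chi> i. z $ i mod ?p ^ K"
    define y' where "y' = (\<chi> j. y $ j mod ?p ^ K)"
    let ?X = "{x \<in> residue_box ?p K. reduced_map K F x = y'}"
    have r: "?r ` ?Z \<subseteq> ?X"
    proof
      fix x assume "x \<in> ?r ` ?Z"
      then obtain z where z: "z \<in> ?Z" "x = ?r z" by blast
      \<comment> \<open>Remainder and quotient by p^K recover \<open>z\<close>.\<close>
      have "(\<chi> i. x $ i + ?p ^ K * (\<chi> i. z $ i div ?p ^ K) $ i) = z"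
        by (simp add: z(2) vec_eq_iff)
      then have "reduced_map (Suc K) F (\<chi> i. x $ i + ?p ^ K * (\<chi> i. z $ i div ?p ^ K) $ i) = y"
        using z(1) by simp
      then have "reduced_map K F x = y'"
        unfolding y'_def by (rule reduced_map_lift [OF J K])
      then show "x \<in> ?X"
        using p by (simp add: z(2) residue_box_def)
    qed
    have "card ?Z = (\<Sum>x\<in>?X. card {z \<in> ?Z. ?r z = x})"
      using sum.group [OF _ _ r, of "\<lambda>_. 1 :: nat"] by (simp add: finite_residue_box)
    also have "\<dots> = (\<Sum>x\<in>?X. ?q)"
      using card_lifts [OF J K y _ _ rank] by (intro sum.cong) (auto simp: y'_def conj_assoc)
    also have "\<dots> = c * ?q"
      using c [of y'] p by (simp add: y'_def residue_box_def)
    finally show ?thesis .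
  qed
  then show ?thesis
    by (auto simp: equiprobable_mod_def)
qed

section \<open>Full rank at all points and induction on the exponent\<close>

theorem theorem3p7:
  fixes F :: "'p::prime_card padic_int ^ 'n \<Rightarrow> 'p padic_int ^ 'm"
    and J :: "'p padic_int ^ 'n \<Rightarrow> 'p padic_int ^ 'm ^ 'n"
    and k :: nat
  assumes "uniformly_differentiable_mod 1 F"
    and "integer_valued_derivatives_mod 1 F"
    and "jacobi_mod 1 F (\<lambda>u. to_padic_mat (J u))"
    and "k \<ge> diff_threshold 1 F"
    and "equiprobable_mod k F"
    and "\<forall>u \<in> residue_box CARD('p) k. rank (reduce_mat_mod_p (J (of_nat_vec u))) = CARD('m)"
  shows "asymptotically_equiprobable F"
proof -
  let ?p = "CARD('p)"
  have p: "0 < ?p" using prime_card_gt_0 [where 'p = 'p] by simp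
  \<comment> \<open>A matrix attaining the least threshold may have entries outside Z_p; the
    integral \<open>J\<close> then takes over that threshold.\<close>
  obtain J\<^sub>0 where "jacobi_mod_from (diff_threshold 1 F) 1 F J\<^sub>0"
    unfolding diff_threshold_def using assms(1) LeastI_ex [of "\<lambda>N. \<exists>J. jacobi_mod_from N 1 F J"]
    by (auto simp: uniformly_differentiable_mod_def)
  then have "jacobi_mod_from (diff_threshold 1 F) 1 F (\<lambda>u. to_padic_mat (J u))"
    using assms(3) jacobi_mod_from_change by (auto simp: jacobi_mod_def)
  then have J: "jacobi_mod_from k 1 F (\<lambda>u. to_padic_mat (J u))"
    using assms(4) by (auto simp: jacobi_mod_from_def)
  \<comment> \<open>The rank is given only at points below p^k. Periodicity modulo p^k carries it to
    the larger boxes met in the induction.\<close>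
  have rank: "rank (reduce_mat_mod_p (J (of_nat_vec x))) = CARD('m)" for x
  proof -
    define x' :: "nat ^ 'n" where "x' = (\<chi> i. x $ i mod ?p ^ k)"
    define h :: "'p padic_int ^ 'n" where "h = of_nat_vec x - of_nat_vec x'"
    have "residue (h $ i) k = 0" for i
      by (simp add: h_def of_nat_vec_def residue_diff_eq_0_iff residue_of_nat x'_def of_nat_mod)
    then have "reduce_mat_mod_p (J (of_nat_vec x' + h)) = reduce_mat_mod_p (J (of_nat_vec x'))"
      by (rule reduce_mat_mod_p_periodic [OF J])
    moreover have "x' \<in> residue_box ?p k"
      using p by (simp add: x'_def residue_box_def)
    ultimately show ?thesis
      using assms(6) by (simp add: h_def)
  qed
  have "equiprobable_mod K F" if "k \<le> K" for K
    using that assms(5) by (induction rule: dec_induct) (auto intro: equiprobable_mod_Suc [OF J] rank)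
  then show ?thesis
    unfolding asymptotically_equiprobable_def eventually_sequentially by blast
qed

end
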